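(* Let $\alpha,\tau>0$ and let $h,k>0$ be the mesh size and time step. Let $\{\boldsymbol m_h^n\}_{n\ge0}$ be grid functions such that $|\boldsymbol m_h^0(\boldsymbol x_l)|=|\boldsymbol m_h^1(\boldsymbol x_l)|=1$ at every grid point $\boldsymbol x_l$ and, for all $n\ge1$, with $\bar{\boldsymbol m}_h^n=\frac12(\boldsymbol m_h^{n+1}+\boldsymbol m_h^{n-1})$, $$d_t\boldsymbol m_h^{n+1}-\alpha\,\bar{\boldsymbol m}_h^n\times\big(d_t\boldsymbol m_h^{n+1}+\tau\,d_{tt}\boldsymbol m_h^n\big)=-\bar{\boldsymbol m}_h^n\times\Delta_h\bar{\boldsymbol m}_h^n$$ at every grid point. Then: (i) $|\boldsymbol m_h^n(\boldsymbol x_l)|=1$ for every grid point $\boldsymbol x_l$ and every $n\ge0$; (ii) for every $n\ge1$, $$\frac12D_t\|\nabla_h\boldsymbol m_h^{n+1}\|_2^2+\alpha\|d_t\boldsymbol m_h^{n+1}\|_2^2+\frac12\alpha\tau\,D_t^-\|d_t^+\boldsymbol m_h^n\|_2^2=0.$$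
   Context: Difference quotients in time: for a sequence of grid functions $\phi^n$, $d_t^+\phi^n=(\phi^{n+1}-\phi^n)/k$, $d_t^-\phi^n=(\phi^n-\phi^{n-1})/k$, $d_t\phi^{n+1}=\frac12(d_t^+\phi^n+d_t^-\phi^n)=(\phi^{n+1}-\phi^{n-1})/(2k)$, $d_{tt}\phi^n=(\phi^{n+1}-2\phi^n+\phi^{n-1})/k^2$. For a sequence of scalars $\psi^n$ define likewise $D_t^+\psi^n=(\psi^{n+1}-\psi^n)/k$, $D_t^-\psi^n=(\psi^n-\psi^{n-1})/k$, $D_t\psi^{n+1}=\frac12(D_t^+\psi^n+D_t^-\psi^n)$. Grid: $\Omega=(0,1)^d$, $d\in\{1,2,3\}$, is divided into $N^d$ uniform cells, $h=1/N$; grid points are the cell centers, e.g. for $d=3$ $\boldsymbol x_{i,j,l}=((i-\tfrac12)h,(j-\tfrac12)h,(l-\tfrac12)h)$ with $1\le i,j,l\le N$. A grid function assigns a vector in $\mathbb R^3$ to each grid point and is extended to ghost points (an index equal to $0$ or $N+1$) by the homogeneous Neumann extrapolation: the value at index $0$ equals the value at index $1$, and the value at index $N+1$ equals the value at index $N$, in each direction. $\Delta_h$ is the standard $(2d+1)$-point (seven-point for $d=3$) discrete Laplacian using these ghost values. $\nabla_h$ is the compact central-difference gradient, with values $(\boldsymbol f_{i+1}-\boldsymbol f_i)/h$ located at the faces between neighbouring cells in each coordinate direction (it vanishes on boundary faces), so that $\langle-\Delta_h\boldsymbol f,\boldsymbol g\rangle=\langle\nabla_h\boldsymbol f,\nabla_h\boldsymbol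 g\rangle$. Discrete inner product and norm: $\langle\boldsymbol f,\boldsymbol g\rangle=h^d\sum_{\boldsymbol x_l}\boldsymbol f(\boldsymbol x_l)\cdot\boldsymbol g(\boldsymbol x_l)$ over all grid points, $\|\boldsymbol f\|_2^2=\langle\boldsymbol f,\boldsymbol f\rangle$; $\|\nabla_h\boldsymbol f\|_2^2$ is $h^d$ times the sum of the squares of all face differences. $|\cdot|$ is the Euclidean norm and $\times$ the cross product in $\mathbb R^3$. *)

theory Defs
  imports "HOL-Analysis.Analysis"
begin

text \<open>
  The cell centre with coordinates \<open>(i\<^sub>e - 1/2) h\<close>, \<open>1 \<le> i\<^sub>e \<le> N\<close>, is represented by its
  multi-index \<open>i :: 'd \<Rightarrow> nat\<close>, where the finite type \<open>'d\<close> indexes the coordinate directions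
  of \<open>(0,1)\<^sup>d\<close>, so that \<open>d = CARD('d)\<close>.  Grid functions are maps on multi-indices; only their
  values on \<open>grid N\<close> enter the operators below, the ghost values being supplied by
  \<open>neumann_ext\<close>.
\<close>

definition mesh :: "nat \<Rightarrow> real" where
  "mesh N = 1 / real N"

definition grid :: "nat \<Rightarrow> ('d::finite \<Rightarrow> nat) set" where
  "grid N = {i. \<forall>e. 1 \<le> i e \<and> i e \<le> N}"

definition neumann_index :: "nat \<Rightarrow> nat \<Rightarrow> nat" where
  "neumann_index N j = (if j = 0 then 1 else if j = N + 1 then N else j)"

definition neumann_ext :: "nat \<Rightarrow> (('d::finite \<Rightarrow> nat) \<Rightarrow> real^3) \<Rightarrow> ('d \<Rightarrow> nat) \<Rightarrow> real^3" where
  "neumann_ext N f i = f (\<lambda>e. neumann_index N (i e))"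

definition laplacian_h :: "nat \<Rightarrow> (('d::finite \<Rightarrow> nat) \<Rightarrow> real^3) \<Rightarrow> ('d \<Rightarrow> nat) \<Rightarrow> real^3" where
  "laplacian_h N f i =
     (\<Sum>e\<in>UNIV. neumann_ext N f (i(e := i e + 1)) - 2 *\<^sub>R neumann_ext N f i
                 + neumann_ext N f (i(e := i e - 1))) /\<^sub>R (mesh N)\<^sup>2"

text \<open>
  The multi-index \<open>i \<in> faces N e\<close> stands for the face between the cells \<open>i\<close> and
  \<open>i(e := i e + 1)\<close>; the values \<open>i e = 0\<close> and \<open>i e = N\<close> are the boundary faces, where
  \<open>grad_h\<close> vanishes because of the ghost values.
\<close>

definition faces :: "nat \<Rightarrow> 'd::finite \<Rightarrow> ('d \<Rightarrow> nat) set" where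
  "faces N e = {i. i e \<le> N \<and> (\<forall>e'. e' \<noteq> e \<longrightarrow> 1 \<le> i e' \<and> i e' \<le> N)}"

definition grad_h ::
  "nat \<Rightarrow> (('d::finite \<Rightarrow> nat) \<Rightarrow> real^3) \<Rightarrow> 'd \<Rightarrow> ('d \<Rightarrow> nat) \<Rightarrow> real^3" where
  "grad_h N f e i = (neumann_ext N f (i(e := i e + 1)) - neumann_ext N f i) /\<^sub>R mesh N"

definition inner_h ::
  "nat \<Rightarrow> (('d::finite \<Rightarrow> nat) \<Rightarrow> real^3) \<Rightarrow> (('d \<Rightarrow> nat) \<Rightarrow> real^3) \<Rightarrow> real" where
  "inner_h N f g = mesh N ^ CARD('d) * (\<Sum>i\<in>grid N. f i \<bullet> g i)"

definition norm_h :: "nat \<Rightarrow> (('d::finite \<Rightarrow> nat) \<Rightarrow> real^3) \<Rightarrow> real" where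
  "norm_h N f = sqrt (inner_h N f f)"

definition face_norm_h :: "nat \<Rightarrow> ('d::finite \<Rightarrow> ('d \<Rightarrow> nat) \<Rightarrow> real^3) \<Rightarrow> real" where
  "face_norm_h N F = sqrt (mesh N ^ CARD('d) * (\<Sum>e\<in>UNIV. \<Sum>i\<in>faces N e. (norm (F e i))\<^sup>2))"

text \<open>
  The backward quotients, the second difference and the average below are meaningful only for \<open>n \<ge> 1\<close> since \<open>0 - 1 = 0\<close> in \<open>nat\<close>.  Following
  the convention \<open>d\<^sub>t \<phi>\<^sup>n\<^sup>+\<^sup>1 = (\<phi>\<^sup>n\<^sup>+\<^sup>1 - \<phi>\<^sup>n\<^sup>-\<^sup>1) / (2k)\<close>, the centred quotient \<open>dt k \<phi> n\<close> is centred
  at time level \<open>n - 1\<close>.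
\<close>

definition dt_plus :: "real \<Rightarrow> (nat \<Rightarrow> 'i \<Rightarrow> real^3) \<Rightarrow> nat \<Rightarrow> 'i \<Rightarrow> real^3" where
  "dt_plus k \<phi> n = (\<lambda>x. (\<phi> (n + 1) x - \<phi> n x) /\<^sub>R k)"

definition dt_minus :: "real \<Rightarrow> (nat \<Rightarrow> 'i \<Rightarrow> real^3) \<Rightarrow> nat \<Rightarrow> 'i \<Rightarrow> real^3" where
  "dt_minus k \<phi> n = (\<lambda>x. (\<phi> n x - \<phi> (n - 1) x) /\<^sub>R k)"

definition dt :: "real \<Rightarrow> (nat \<Rightarrow> 'i \<Rightarrow> real^3) \<Rightarrow> nat \<Rightarrow> 'i \<Rightarrow> real^3" where
  "dt k \<phi> n = (\<lambda>x. (1/2) *\<^sub>R (dt_plus k \<phi> (n - 1) x + dt_minus k \<phi> (n - 1) x))"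

definition dtt :: "real \<Rightarrow> (nat \<Rightarrow> 'i \<Rightarrow> real^3) \<Rightarrow> nat \<Rightarrow> 'i \<Rightarrow> real^3" where
  "dtt k \<phi> n = (\<lambda>x. (\<phi> (n + 1) x - 2 *\<^sub>R \<phi> n x + \<phi> (n - 1) x) /\<^sub>R k\<^sup>2)"

definition time_avg :: "(nat \<Rightarrow> 'i \<Rightarrow> real^3) \<Rightarrow> nat \<Rightarrow> 'i \<Rightarrow> real^3" where
  "time_avg \<phi> n = (\<lambda>x. (1/2) *\<^sub>R (\<phi> (n + 1) x + \<phi> (n - 1) x))"

definition Dt_plus :: "real \<Rightarrow> (nat \<Rightarrow> real) \<Rightarrow> nat \<Rightarrow> real" where
  "Dt_plus k \<psi> n = (\<psi> (n + 1) - \<psi> n) / k"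

definition Dt_minus :: "real \<Rightarrow> (nat \<Rightarrow> real) \<Rightarrow> nat \<Rightarrow> real" where
  "Dt_minus k \<psi> n = (\<psi> n - \<psi> (n - 1)) / k"

definition Dt :: "real \<Rightarrow> (nat \<Rightarrow> real) \<Rightarrow> nat \<Rightarrow> real" where
  "Dt k \<psi> n = (1/2) * (Dt_plus k \<psi> (n - 1) + Dt_minus k \<psi> (n - 1))"

end

theory Submission
  imports Defs
begin

text \<open>
  The scheme has the form \<open>d\<^sub>t m = m\<^sub>a \<times> w\<close> with \<open>m\<^sub>a\<close> the time average and
  \<open>w = \<alpha> (d\<^sub>t m + \<tau> d\<^sub>t\<^sub>t m) - \<Delta>\<^sub>h m\<^sub>a\<close>, so \<open>d\<^sub>t m\<close> is pointwise orthogonal both to \<open>m\<^sub>a\<close> and to \<open>w\<close>.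
  Orthogonality to \<open>m\<^sub>a\<close> says that \<open>|m\<^sup>n\<^sup>+\<^sup>1| = |m\<^sup>n\<^sup>-\<^sup>1|\<close>.  Orthogonality to \<open>w\<close>, summed over
  the grid, becomes the energy identity after one summation by parts, since each of
  \<open>d\<^sub>t m \<bullet> d\<^sub>t\<^sub>t m\<close> and \<open>\<nabla>\<^sub>h d\<^sub>t m \<bullet> \<nabla>\<^sub>h m\<^sub>a\<close> is a difference of squares.
\<close>

text \<open>The polarised form of the square of \<open>face_norm_h\<close>: summation by parts pairs
  the gradients of two different grid functions.\<close>

definition face_inner_h ::
  "nat \<Rightarrow> ('d::finite \<Rightarrow> ('d \<Rightarrow> nat) \<Rightarrow> real^3) \<Rightarrow> ('d \<Rightarrow> ('d \<Rightarrow> nat) \<Rightarrow> real^3) \<Rightarrow> real" where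
  "face_inner_h N F G = mesh N ^ CARD('d) * (\<Sum>e\<in>UNIV. \<Sum>i\<in>faces N e. F e i \<bullet> G e i)"

lemma face_norm_h_power2: "(face_norm_h N F)\<^sup>2 = face_inner_h N F F"
  by (simp add: face_norm_h_def face_inner_h_def mesh_def sum_nonneg power2_norm_eq_inner)

lemma norm_h_power2: "(norm_h N f)\<^sup>2 = inner_h N f f"
  by (simp add: norm_h_def inner_h_def mesh_def sum_nonneg)

lemma finite_faces [simp]: "finite (faces N (e :: 'd::finite))"
proof -
  have "finite (PiE (UNIV :: 'd set) (\<lambda>_. {0..N}))"
    by (intro finite_PiE) auto
  moreover have "faces N e \<subseteq> PiE UNIV (\<lambda>_. {0..N})"
    unfolding faces_def by (force simp: PiE_def Pi_def)
  ultimately show ?thesis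
    by (rule finite_subset[rotated])
qed

lemma neumann_ext_on_grid: "i \<in> grid N \<Longrightarrow> neumann_ext N f i = f i"
proof -
  assume "i \<in> grid N"
  then have "neumann_index N (i e) = i e" for e
    unfolding grid_def neumann_index_def by (smt (verit) mem_Collect_eq not_one_le_zero
        add.commute not_less_eq_eq plus_1_eq_Suc order_refl)
  then show ?thesis
    by (simp add: neumann_ext_def)
qed

text \<open>\<open>neumann_index\<close> sends 0 and 1 to 1, and N and N + 1 to N, so both sides
  evaluate \<open>f\<close> at the same multi-index, whatever the other coordinates are. For N = 0
  the two rules would collide.\<close>

lemma neumann_ext_boundary_face:
  assumes "N \<ge> 1" "i e = 0 \<or> i e = N"
  shows "neumann_ext N f (i(e := i e + 1)) = neumann_ext N f i"
proof -
  have "(\<lambda>e'. neumann_index N ((i(e := i e + 1)) e')) = (\<lambda>e'. neumann_index N (i e'))"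
    using assms by (auto simp: fun_eq_iff neumann_index_def)
  then show ?thesis
    by (simp only: neumann_ext_def)
qed

text \<open>Abel summation in direction \<open>e\<close>: the second difference at a cell is the
  flux \<open>q\<close> through its upper face minus that through its lower face. Shifting the index
  in the lower-face sum moves the difference onto \<open>G\<close>.\<close>

lemma sum_by_parts_direction:
  fixes f g :: "('d::finite \<Rightarrow> nat) \<Rightarrow> real^3" and e :: 'd
  assumes N: "N \<ge> 1"
  defines "F \<equiv> neumann_ext N f" and "G \<equiv> neumann_ext N g"
  shows "(\<Sum>i\<in>grid N. (F (i(e := i e + 1)) - 2 *\<^sub>R F i + F (i(e := i e - 1))) \<bullet> g i)
    = - (\<Sum>i\<in>faces N e. (F (i(e := i e + 1)) - F i) \<bullet> (G (i(e := i e + 1)) - G i))"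
proof -
  define q where "q i = F (i(e := i e + 1)) - F i" for i
  \<comment> \<open>Fluxes through the boundary faces vanish, which lets the sums over cells, shifted or not,
    be extended to all faces.\<close>
  have q0: "q i = 0" if "i e = 0 \<or> i e = N" for i
    using neumann_ext_boundary_face[of N i e f] N that by (simp add: q_def F_def)
  have sub: "grid N \<subseteq> faces N e"
    by (auto simp: grid_def faces_def)
  \<comment> \<open>The lower faces of all cells, that is, the image of the grid under the shift by
    -1 in direction \<open>e\<close>. Only the upper boundary faces are missing.\<close>
  define L where "L = {i \<in> faces N e. i e < N}"
  have "(\<Sum>i\<in>grid N. (F (i(e := i e + 1)) - 2 *\<^sub>R F i + F (i(e := i e - 1))) \<bullet> g i)
      = (\<Sum>i\<in>grid N. q i \<bullet> G i - q (i(e := i e - 1)) \<bullet> G i)"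
  proof (rule sum.cong[OF refl])
    fix i :: "'d \<Rightarrow> nat" assume i: "i \<in> grid N"
    \<comment> \<open>Ensures that the subtraction in nat is not truncated, so that the upward shift
      undoes the downward one.\<close>
    then have "i e \<ge> 1" by (simp add: grid_def)
    then have "(i(e := i e - 1))(e := (i(e := i e - 1)) e + 1) = i"
      by (auto simp: fun_eq_iff)
    then have "q (i(e := i e - 1)) = F i - F (i(e := i e - 1))"
      by (simp only: q_def)
    moreover have "G i = g i"
      using i by (simp add: G_def neumann_ext_on_grid)
    ultimately show "(F (i(e := i e + 1)) - 2 *\<^sub>R F i + F (i(e := i e - 1))) \<bullet> g i
        = q i \<bullet> G i - q (i(e := i e - 1)) \<bullet> G i"
      by (simp add: q_def inner_diff_left inner_add_left)
  qed
  also have "\<dots> = (\<Sum>i\<in>grid N. q i \<bullet> G i) - (\<Sum>i\<in>grid N. q (i(e := i e - 1)) \<bullet> G i)"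
    by (rule sum_subtractf)
  also have "(\<Sum>i\<in>grid N. q i \<bullet> G i) = (\<Sum>i\<in>faces N e. q i \<bullet> G i)"
  proof (rule sum.mono_neutral_left[OF finite_faces sub], rule ballI)
    fix i assume "i \<in> faces N e - grid N"
    then have "i e = 0"
      unfolding faces_def grid_def
      by (smt (verit) DiffD1 DiffD2 mem_Collect_eq less_one not_le)
    then show "q i \<bullet> G i = 0" by (simp add: q0)
  qed
  also have "(\<Sum>i\<in>grid N. q (i(e := i e - 1)) \<bullet> G i) = (\<Sum>i\<in>L. q i \<bullet> G (i(e := i e + 1)))"
    by (rule sum.reindex_bij_witness[where i = "\<lambda>i. i(e := i e + 1)" and j = "\<lambda>i. i(e := i e - 1)"])
       (auto simp: L_def grid_def faces_def Suc_le_eq dest: spec[of _ e])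
  also have "\<dots> = (\<Sum>i\<in>faces N e. q i \<bullet> G (i(e := i e + 1)))"
  proof (rule sum.mono_neutral_left[OF finite_faces], unfold L_def, blast, rule ballI)
    fix i assume "i \<in> faces N e - {i \<in> faces N e. i e < N}"
    then have "i e = N" by (auto simp: faces_def)
    then show "q i \<bullet> G (i(e := i e + 1)) = 0" by (simp add: q0)
  qed
  also have "(\<Sum>i\<in>faces N e. q i \<bullet> G i) - (\<Sum>i\<in>faces N e. q i \<bullet> G (i(e := i e + 1)))
     = - (\<Sum>i\<in>faces N e. q i \<bullet> (G (i(e := i e + 1)) - G i))"
    by (simp add: inner_diff_right sum_subtractf)
  finally show ?thesis
    by (simp only: q_def)
qed

lemma inner_h_laplacian_h:
  fixes f g :: "('d::finite \<Rightarrow> nat) \<Rightarrow> real^3"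
  assumes N: "N \<ge> 1"
  shows "inner_h N (laplacian_h N f) g = - face_inner_h N (grad_h N f) (grad_h N g)"
proof -
  let ?F = "neumann_ext N f" and ?G = "neumann_ext N g"
  have "(\<Sum>i\<in>grid N. laplacian_h N f i \<bullet> g i)
    = inverse ((mesh N)\<^sup>2) * (\<Sum>i\<in>grid N. \<Sum>e\<in>UNIV.
        (?F (i(e := i e + 1)) - 2 *\<^sub>R ?F i + ?F (i(e := i e - 1))) \<bullet> g i)"
    unfolding laplacian_h_def inner_scaleR_left inner_sum_left by (simp only: sum_distrib_left)
  also have "\<dots> = inverse ((mesh N)\<^sup>2) * (\<Sum>e\<in>UNIV. \<Sum>i\<in>grid N.
        (?F (i(e := i e + 1)) - 2 *\<^sub>R ?F i + ?F (i(e := i e - 1))) \<bullet> g i)"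
    by (subst sum.swap) (rule refl)
  also have "\<dots> = inverse ((mesh N)\<^sup>2) * (\<Sum>e\<in>UNIV. - (\<Sum>i\<in>faces N e.
        (?F (i(e := i e + 1)) - ?F i) \<bullet> (?G (i(e := i e + 1)) - ?G i)))"
    by (simp only: sum_by_parts_direction[OF N])
  \<comment> \<open>The factor \<open>1 / h^2\<close> is shared out, one \<open>1 / h\<close> to
    each gradient.\<close>
  also have "\<dots> = - (\<Sum>e\<in>UNIV. \<Sum>i\<in>faces N e. grad_h N f e i \<bullet> grad_h N g e i)"
    by (simp add: grad_h_def sum_negf sum_distrib_left power2_eq_square mult.assoc)
  finally show ?thesis
    by (simp add: inner_h_def face_inner_h_def)
qed

lemma dt_Suc:
  assumes "n \<ge> 1"
  shows "dt k \<phi> (n + 1) x = (1 / (2 * k)) *\<^sub>R (\<phi> (n + 1) x - \<phi> (n - 1) x)"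
  by (simp add: dt_def dt_plus_def dt_minus_def inverse_eq_divide flip: scaleR_add_right)

lemma Dt_Suc:
  assumes "n \<ge> 1"
  shows "Dt k \<psi> (n + 1) = (\<psi> (n + 1) - \<psi> (n - 1)) / (2 * k)"
  by (simp add: Dt_def Dt_plus_def Dt_minus_def flip: add_divide_distrib)

lemma inner_diff_add: "(a - b) \<bullet> (a + b) = a \<bullet> a - b \<bullet> b" for a b :: "'a::real_inner"
  by (simp add: inner_diff_left inner_add_right inner_commute[of b a])

text \<open>A difference of squares: \<open>4 * k\<close> collects \<open>2 * k\<close> from the
  centred quotient and 2 from the average. The index type is arbitrary, so this applies to values at
  cells and at faces alike.\<close>

lemma inner_dt_time_avg:
  assumes "n \<ge> 1"
  shows "dt k \<phi> (n + 1) x \<bullet> time_avg \<phi> n x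
    = ((norm (\<phi> (n + 1) x))\<^sup>2 - (norm (\<phi> (n - 1) x))\<^sup>2) / (4 * k)"
  unfolding dt_Suc[OF assms] time_avg_def power2_norm_eq_inner
  by (simp add: inner_diff_add)

text \<open>The centred quotient is the mean of two consecutive forward quotients and
  \<open>dtt\<close> is their difference over \<open>k\<close>, so the product is again a difference
  of squares.\<close>

lemma inner_dt_dtt:
  assumes "n \<ge> 1" "k \<noteq> 0"
  shows "dt k \<phi> (n + 1) x \<bullet> dtt k \<phi> n x
    = (dt_plus k \<phi> n x \<bullet> dt_plus k \<phi> n x
        - dt_plus k \<phi> (n - 1) x \<bullet> dt_plus k \<phi> (n - 1) x) / (2 * k)"
proof -
  have "dt k \<phi> (n + 1) x = (1/2) *\<^sub>R (dt_plus k \<phi> n x + dt_plus k \<phi> (n - 1) x)"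
    using assms by (simp add: dt_def dt_plus_def dt_minus_def)
  moreover have "dtt k \<phi> n x = (1 / k) *\<^sub>R (dt_plus k \<phi> n x - dt_plus k \<phi> (n - 1) x)"
    using assms by (simp add: dtt_def dt_plus_def divide_inverse power2_eq_square scaleR_2
        flip: scaleR_diff_right)
  ultimately show ?thesis
    by (simp add: inner_commute[of "_ + _"] inner_diff_add)
qed

lemma grad_h_dt: "grad_h N (dt k \<phi> n) e i = dt k (\<lambda>p. grad_h N (\<phi> p) e) n i"
  by (simp add: grad_h_def neumann_ext_def dt_def dt_plus_def dt_minus_def algebra_simps)

lemma grad_h_time_avg: "grad_h N (time_avg \<phi> n) e i = time_avg (\<lambda>p. grad_h N (\<phi> p) e) n i"
  by (simp add: grad_h_def neumann_ext_def time_avg_def algebra_simps)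

text \<open>The gradient is linear and so commutes with the time operators; this reduces the claim
  to \<open>inner_dt_time_avg\<close> at each face. The factor 1/2 is \<open>4 * k\<close> against
  the \<open>2 * k\<close> in \<open>Dt\<close>.\<close>

lemma face_inner_h_grad_h_time_avg_dt:
  assumes "n \<ge> 1"
  shows "face_inner_h N (grad_h N (time_avg \<phi> n)) (grad_h N (dt k \<phi> (n + 1)))
    = (1/2) * Dt k (\<lambda>p. (face_norm_h N (grad_h N (\<phi> p)))\<^sup>2) (n + 1)"
proof -
  have "grad_h N (time_avg \<phi> n) e i \<bullet> grad_h N (dt k \<phi> (n + 1)) e i
      = (grad_h N (\<phi> (n + 1)) e i \<bullet> grad_h N (\<phi> (n + 1)) e i
          - grad_h N (\<phi> (n - 1)) e i \<bullet> grad_h N (\<phi> (n - 1)) e i) / (4 * k)" for e i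
    unfolding grad_h_dt grad_h_time_avg
    by (subst inner_commute) (simp add: inner_dt_time_avg[OF assms, unfolded Suc_eq_plus1]
        power2_norm_eq_inner del: One_nat_def)
  then show ?thesis
    unfolding Dt_Suc[OF assms] face_norm_h_power2 face_inner_h_def
    by (simp add: sum_subtractf right_diff_distrib diff_divide_distrib flip: sum_divide_distrib)
qed

lemma inner_h_dt_dtt:
  assumes "n \<ge> 1" "k \<noteq> 0"
  shows "inner_h N (dt k \<phi> (n + 1)) (dtt k \<phi> n)
    = (1/2) * Dt_minus k (\<lambda>p. (norm_h N (dt_plus k \<phi> p))\<^sup>2) n"
  unfolding norm_h_power2 Dt_minus_def inner_h_def inner_dt_dtt[OF assms]
  by (simp only: sum_subtractf flip: sum_divide_distrib) (simp add: field_simps)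

theorem lemma2p1:
  fixes \<alpha> \<tau> k :: real
    and N :: nat
    and m :: "nat \<Rightarrow> ('d::finite \<Rightarrow> nat) \<Rightarrow> real^3"
  assumes dim: "CARD('d) \<in> {1, 2, 3}"
    and N: "N \<ge> 1"
    and \<alpha>: "\<alpha> > 0" and \<tau>: "\<tau> > 0" and k: "k > 0"
    and init0: "\<forall>x\<in>grid N. norm (m 0 x) = 1"
    and init1: "\<forall>x\<in>grid N. norm (m 1 x) = 1"
    and scheme: "\<forall>n\<ge>1. \<forall>x\<in>grid N.
      dt k m (n + 1) x
        - \<alpha> *\<^sub>R cross3 (time_avg m n x) (dt k m (n + 1) x + \<tau> *\<^sub>R dtt k m n x)
      = - cross3 (time_avg m n x) (laplacian_h N (time_avg m n) x)"
  shows "(\<forall>n. \<forall>x\<in>grid N. norm (m n x) = 1) \<and>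
    (\<forall>n\<ge>1.
      (1/2) * Dt k (\<lambda>p. (face_norm_h N (grad_h N (m p)))\<^sup>2) (n + 1)
        + \<alpha> * (norm_h N (dt k m (n + 1)))\<^sup>2
        + (1/2) * \<alpha> * \<tau> * Dt_minus k (\<lambda>p. (norm_h N (dt_plus k m p))\<^sup>2) n = 0)"
proof -
  define w where "w n x = \<alpha> *\<^sub>R (dt k m (n + 1) x + \<tau> *\<^sub>R dtt k m n x)
      - laplacian_h N (time_avg m n) x" for n x
  have dt_eq: "dt k m (n + 1) x = cross3 (time_avg m n x) (w n x)" if "n \<ge> 1" "x \<in> grid N" for n x
  proof -
    have "cross3 (time_avg m n x) (w n x)
      = \<alpha> *\<^sub>R cross3 (time_avg m n x) (dt k m (n + 1) x + \<tau> *\<^sub>R dtt k m n x)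
        - cross3 (time_avg m n x) (laplacian_h N (time_avg m n) x)"
      by (simp only: w_def Cross3.right_diff_distrib cross_mult_right)
    moreover have "dt k m (n + 1) x
        = \<alpha> *\<^sub>R cross3 (time_avg m n x) (dt k m (n + 1) x + \<tau> *\<^sub>R dtt k m n x)
          + - cross3 (time_avg m n x) (laplacian_h N (time_avg m n) x)"
      using scheme[rule_format, OF that] by (metis diff_eq_eq add.commute)
    ultimately show ?thesis
      by (metis diff_conv_add_uminus)
  qed
  have unit: "\<forall>x\<in>grid N. norm (m n x) = 1" for n
  \<comment> \<open>The scheme at level n - 1 links levels n and n - 2, so both initial levels serve
    as base cases.\<close>
  proof (induction n rule: less_induct)
    case (less n)
    show ?case
    proof (cases "n \<le> 1")
      case True
      then show ?thesis
        using init0 init1 by (cases n) auto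
    next
      case False
      show ?thesis
      proof
        fix x :: "'d \<Rightarrow> nat" assume x: "x \<in> grid N"
        have n: "n - 1 \<ge> 1" "n - 1 + 1 = n" "n - 1 - 1 < n" using False by auto
        have "dt k m (n - 1 + 1) x \<bullet> time_avg m (n - 1) x = 0"
          unfolding dt_eq[OF n(1) x] by (simp add: dot_cross_self)
        then have "(norm (m n x))\<^sup>2 = (norm (m (n - 1 - 1) x))\<^sup>2"
          unfolding inner_dt_time_avg[OF n(1)] unfolding n(2) using k by simp
        then show "norm (m n x) = 1"
          using less.IH[OF n(3)] x by (simp add: power2_eq_1_iff)
      qed
    qed
  qed
  have energy: "(1/2) * Dt k (\<lambda>p. (face_norm_h N (grad_h N (m p)))\<^sup>2) (n + 1)
        + \<alpha> * (norm_h N (dt k m (n + 1)))\<^sup>2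
        + (1/2) * \<alpha> * \<tau> * Dt_minus k (\<lambda>p. (norm_h N (dt_plus k m p))\<^sup>2) n = 0"
    if n: "n \<ge> 1" for n
  proof -
    let ?v = "dt k m (n + 1)" and ?a = "dtt k m n"
    let ?l = "laplacian_h N (time_avg m n)"
    have "\<alpha> * (?v x \<bullet> ?v x) + \<alpha> * \<tau> * (?v x \<bullet> ?a x) - ?l x \<bullet> ?v x = 0" if "x \<in> grid N" for x
    proof -
      have "?v x \<bullet> w n x = 0"
        unfolding dt_eq[OF n that] by (simp add: dot_cross_self)
      then show ?thesis
        by (simp add: w_def inner_diff_right inner_add_right inner_commute algebra_simps)
    qed
    then have "(\<Sum>x\<in>grid N. \<alpha> * (?v x \<bullet> ?v x) + \<alpha> * \<tau> * (?v x \<bullet> ?a x) - ?l x \<bullet> ?v x) = 0"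
      by simp
    then have "mesh N ^ CARD('d) * (\<alpha> * (\<Sum>x\<in>grid N. ?v x \<bullet> ?v x)
        + \<alpha> * \<tau> * (\<Sum>x\<in>grid N. ?v x \<bullet> ?a x) - (\<Sum>x\<in>grid N. ?l x \<bullet> ?v x)) = 0"
      by (simp add: sum_subtractf sum.distrib sum_distrib_left)
    then have "\<alpha> * inner_h N ?v ?v + \<alpha> * \<tau> * inner_h N ?v ?a - inner_h N ?l ?v = 0"
      unfolding inner_h_def by (simp only: algebra_simps)
    \<comment> \<open>The minus sign from summation by parts cancels the one before the Laplacian in
      \<open>w\<close>, so the gradient energy enters with a plus sign.\<close>
    moreover have "inner_h N ?l ?v
        = - ((1/2) * Dt k (\<lambda>p. (face_norm_h N (grad_h N (m p)))\<^sup>2) (n + 1))"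
      by (simp only: inner_h_laplacian_h[OF N] face_inner_h_grad_h_time_avg_dt[OF n])
    moreover have "inner_h N ?v ?a = (1/2) * Dt_minus k (\<lambda>p. (norm_h N (dt_plus k m p))\<^sup>2) n"
      by (rule inner_h_dt_dtt[OF n]) (use k in simp)
    ultimately show ?thesis
      by (simp only: norm_h_power2[of N ?v])
  qed
  show ?thesis
    using unit energy by blast
qed

end
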